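(* Let $N\ge 1$ and let $E:\mathbb{R}^N\to\mathbb{R}$ be strictly convex and twice continuously differentiable, with positive definite Hessian $W(x):=\partial_x^2E(x)$ at every $x\in\mathbb{R}^N$. Let $\Delta:\mathbb{R}^N\to(0,\infty)$ be a function and put $$\mathbb{U}(x):=\{u\in\mathbb{R}^N:\ \langle u, W(x)u\rangle\le\Delta(x)\}.$$ Let $$V^C(\lambda):=\max_{1\le i\le N}\tfrac12(\lambda^i)^2,\qquad \lambda=(\lambda^1,\dots,\lambda^N)\in\mathbb{R}^N .$$ Then the maximum principle with $V=V^C$ generates the coordinate descent algorithm, in the following sense. Let $\nu_0>0$, let $(h_k)_{k\ge 0}$ be positive reals, and let $(x_k)_{k\ge0}$ in $\mathbb{R}^N$ satisfy $x_{k+1}=x_k+h_ku_k$, where, for each $k$ with $\partial_xE(x_k)\neq 0$, $u_k$ is a solution of $$\text{Maximize}_{u\in\mathbb{U}(x_k)}\ \langle \xi_k,\ \partial_x^2E(x_k)\,u\rangle ,$$ with $\lambda_k:=-\nu_0\,\partial_xE(x_k)$ and $\xi_k\in\partial V^C(\lambda_k)$ the unbiased subgradient of $V^C$ at $\lambda_k$. Then for every $k$ with $\partial_xE(x_k)\neq0$ there is a step size $\alpha_k>0$ such that $$x_{k+1}=x_k-\alpha_k\, q\circ\partial_xE(x_k),$$ where $q=q(\lambda_k)$.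
   Context: $\partial_xE$ and $\partial_x^2E$ denote the gradient and Hessian of $E$; $\langle\cdot,\cdot\rangle$ is the Euclidean inner product and $\circ$ is the Hadamard (componentwise) product of vectors. For $\lambda\in\mathbb{R}^N$, the vector $q(\lambda)\in\{0,1\}^N$ is defined by $q^i=1$ if $(\lambda^i)^2=\max_j(\lambda^j)^2$ and $q^i=0$ otherwise. $\partial V^C(\lambda)$ is the (convex) subdifferential of $V^C$ at $\lambda$; explicitly, it is the convex hull of the vectors $\lambda^i e_i=(0,\dots,\lambda^i,\dots,0)$ over those $i$ with $\tfrac12(\lambda^i)^2=V^C(\lambda)$. The unbiased subgradient of $V^C$ at $\lambda\ne0$ is the vector $\gamma\,q(\lambda)\circ\lambda$, where $\gamma>0$ is chosen so that $\gamma\,q(\lambda)\circ\lambda\in\partial V^C(\lambda)$. Background meaning of the maximum principle: to minimize $E$ one considers a trajectory $\dot x=u$ with costate $\lambda=-\nu_0\,\partial_xE(x)$, $\nu_0>0$, so that $\dot\lambda=-\nu_0\,\partial_x^2E(x)u$. Given a positive definite function $V$ of $\lambda$ (a candidate control Lyapunov function) and a compact control set $\mathbb{U}$, the maximum principle selects the control $u\in\mathbb{U}$ maximizing $\langle\xi,\partial_x^2E(x)u\rangle$ for a subgradient $\xi\in\partial V(\lambda)$. The algorithm is the forward Euler discretization $x_{k+1}=x_k+h_ku_k$, $h_k>0$. *)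

theory Defs
  imports "HOL-Analysis.Analysis"
begin

definition gradient :: "('a::real_inner \<Rightarrow> real) \<Rightarrow> 'a \<Rightarrow> 'a" where
  "gradient f x = (THE D. GDERIV f x :> D)"

definition hessian :: "(real^'n \<Rightarrow> real) \<Rightarrow> real^'n \<Rightarrow> real^'n^'n" where
  "hessian f x = jacobian (gradient f) (at x)"

definition twice_continuously_differentiable :: "(real^'n \<Rightarrow> real) \<Rightarrow> bool" where
  "twice_continuously_differentiable f \<longleftrightarrow>
     (\<forall>x. f differentiable at x) \<and>
     (\<forall>x. gradient f differentiable at x) \<and>
     continuous_on UNIV (hessian f)"

definition strictly_convex_on :: "'a::real_vector set \<Rightarrow> ('a \<Rightarrow> real) \<Rightarrow> bool" where
  "strictly_convex_on S f \<longleftrightarrow> convex S \<and>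
     (\<forall>x\<in>S. \<forall>y\<in>S. \<forall>u>0. \<forall>v>0. x \<noteq> y \<longrightarrow> u + v = 1 \<longrightarrow>
        f (u *\<^sub>R x + v *\<^sub>R y) < u * f x + v * f y)"

text \<open>
  Only the quadratic form is constrained. For the Hessian of a twice continuously
  differentiable function, symmetry holds by Schwarz's theorem.
\<close>
definition positive_definite :: "real^'n^'n \<Rightarrow> bool" where
  "positive_definite A \<longleftrightarrow> (\<forall>u. u \<noteq> 0 \<longrightarrow> u \<bullet> (A *v u) > 0)"

definition subdifferential :: "('a::real_inner \<Rightarrow> real) \<Rightarrow> 'a \<Rightarrow> 'a set" where
  "subdifferential f x = {v. \<forall>y. f y \<ge> f x + v \<bullet> (y - x)}"

definition VC :: "real^'n \<Rightarrow> real" where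
  "VC l = (MAX i. 1/2 * (l $ i)\<^sup>2)"

definition qvec :: "real^'n \<Rightarrow> real^'n" where
  "qvec l = (\<chi> i. if (l $ i)\<^sup>2 = (MAX j. (l $ j)\<^sup>2) then 1 else 0)"

text \<open>The product \<open>*\<close> on \<open>real^'n\<close> is the componentwise (Hadamard) product.\<close>
definition is_unbiased_subgradient :: "real^'n \<Rightarrow> real^'n \<Rightarrow> bool" where
  "is_unbiased_subgradient l xi \<longleftrightarrow>
     (\<exists>\<gamma>>0. xi = \<gamma> *\<^sub>R (qvec l * l) \<and> xi \<in> subdifferential VC l)"

definition control_set ::
    "(real^'n \<Rightarrow> real) \<Rightarrow> (real^'n \<Rightarrow> real) \<Rightarrow> real^'n \<Rightarrow> (real^'n) set" where
  "control_set E \<Delta> x = {u. u \<bullet> (hessian E x *v u) \<le> \<Delta> x}"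

definition solves_max_principle ::
    "(real^'n \<Rightarrow> real) \<Rightarrow> (real^'n \<Rightarrow> real) \<Rightarrow> real^'n \<Rightarrow> real^'n \<Rightarrow> real^'n \<Rightarrow> bool" where
  "solves_max_principle E \<Delta> x xi u \<longleftrightarrow>
     is_arg_max (\<lambda>u. xi \<bullet> (hessian E x *v u)) (\<lambda>u. u \<in> control_set E \<Delta> x) u"

text \<open>
  The unbiased subgradient exists and is unique at every nonzero point, so the predicate above
  determines the vector; the factor is the reciprocal of the number of active indices.
\<close>
lemma ex1_unbiased_subgradient:
  fixes l :: "real^'n"
  assumes "l \<noteq> 0"
  shows "\<exists>!xi. is_unbiased_subgradient l xi"
proof -
  define m where "m = (MAX j. (l $ j)\<^sup>2)"
  define I where "I = {i. (l $ i)\<^sup>2 = m}"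
  have VC_ge: "1/2 * (y $ i)\<^sup>2 \<le> VC y" for y :: "real^'n" and i
    unfolding VC_def by (rule Max_ge) auto
  have m_ge: "(l $ i)\<^sup>2 \<le> m" for i
    unfolding m_def by (rule Max_ge) auto
  have "m \<in> range (\<lambda>j. (l $ j)\<^sup>2)"
    unfolding m_def by (rule Max_in) auto
  then have I_ne: "I \<noteq> {}" unfolding I_def by auto
  have cI: "real (card I) > 0" using I_ne by (simp add: card_gt_0_iff)
  obtain i0 where "l $ i0 \<noteq> 0" using assms by (auto simp: vec_eq_iff)
  then have m_pos: "m > 0" using m_ge[of i0] by (smt (verit) zero_less_power2)
  have VCl: "VC l = 1/2 * m"
  proof (rule antisym)
    show "VC l \<le> 1/2 * m" unfolding VC_def using m_ge by (subst Max_le_iff) auto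
    obtain i where "i \<in> I" using I_ne by auto
    then show "1/2 * m \<le> VC l" using VC_ge[of l i] by (simp add: I_def)
  qed
  have q: "(qvec l * l) $ i = (if i \<in> I then l $ i else 0)" for i
    by (simp add: qvec_def I_def m_def)
  have inner: "(qvec l * l) \<bullet> z = (\<Sum>i\<in>I. l $ i * z $ i)" for z
  proof -
    have "(qvec l * l) \<bullet> z = (\<Sum>i\<in>UNIV. if i \<in> I then l $ i * z $ i else 0)"
      unfolding inner_vec_def by (intro sum.cong refl) (simp only: q, simp)
    then show ?thesis by (simp add: sum.If_cases)
  qed
  have inner_l: "(qvec l * l) \<bullet> l = card I * m"
    unfolding inner by (simp add: I_def power2_eq_square)
  let ?xi = "(1 / card I) *\<^sub>R (qvec l * l)"
  have mem: "?xi \<in> subdifferential VC l"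
    unfolding subdifferential_def
  proof (intro CollectI allI)
    fix y :: "real^'n"
    have "(\<Sum>i\<in>I. m/2 + l $ i * (y $ i - l $ i)) \<le> (\<Sum>i\<in>I. VC y)"
    proof (rule sum_mono)
      fix i assume "i \<in> I"
      then have "m = (l $ i)\<^sup>2" by (simp add: I_def)
      moreover have "(l $ i)\<^sup>2/2 + l $ i * (y $ i - l $ i) \<le> 1/2 * (y $ i)\<^sup>2"
        using zero_le_power2[of "y $ i - l $ i"] by (simp add: power2_eq_square algebra_simps)
      ultimately show "m/2 + l $ i * (y $ i - l $ i) \<le> VC y" using VC_ge[of y i] by simp
    qed
    then have "card I * (m/2) + (qvec l * l) \<bullet> (y - l) \<le> card I * VC y"
      by (simp add: inner sum.distrib)
    also have "card I * (m/2) + (qvec l * l) \<bullet> (y - l) = card I * (VC l + ?xi \<bullet> (y - l))"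
      using cI I_ne by (simp add: VCl distrib_left)
    finally show "VC l + ?xi \<bullet> (y - l) \<le> VC y"
      using cI by (rule mult_left_le_imp_le)
  qed
  have uniq: "\<gamma> = 1 / card I"
    if sub: "\<gamma> *\<^sub>R (qvec l * l) \<in> subdifferential VC l" for \<gamma>
  proof -
    have VCs: "VC (t *\<^sub>R l) \<le> t\<^sup>2 * (m/2)" for t
      unfolding VC_def using m_ge
      by (subst Max_le_iff) (auto simp: power_mult_distrib intro!: mult_left_mono)
    have *: "m/2 + \<gamma> * (t - 1) * (card I * m) \<le> t\<^sup>2 * (m/2)" for t
    proof -
      have "VC l + (\<gamma> *\<^sub>R (qvec l * l)) \<bullet> (t *\<^sub>R l - l) \<le> VC (t *\<^sub>R l)"
        using sub by (simp add: subdifferential_def)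
      moreover have "(\<gamma> *\<^sub>R (qvec l * l)) \<bullet> (t *\<^sub>R l - l) = \<gamma> * (t - 1) * (card I * m)"
        by (simp add: inner_diff_right inner_l) (simp add: algebra_simps)
      ultimately show ?thesis using VCs[of t] VCl by linarith
    qed
    define d where "d = \<gamma> * card I"
    have "m * (1 + 2 * d * (t - 1)) \<le> m * t\<^sup>2" for t
      using *[of t] by (simp add: d_def algebra_simps)
    then have "1 + 2 * d * (t - 1) \<le> t\<^sup>2" for t
      using m_pos by simp
    from this[of d] have "(d - 1)\<^sup>2 \<le> 0" by (simp add: power2_eq_square algebra_simps)
    then have "d = 1" by simp
    then show ?thesis using cI unfolding d_def by (metis less_numeral_extra(3) nonzero_eq_divide_eq)
  qed
  show ?thesis
  proof (rule ex1I)
    show "is_unbiased_subgradient l ?xi"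
      unfolding is_unbiased_subgradient_def using mem cI by (intro exI[of _ "1 / card I"]) auto
    show "xi = ?xi" if "is_unbiased_subgradient l xi" for xi
      using that uniq unfolding is_unbiased_subgradient_def by auto
  qed
qed

end

theory Submission
  imports Defs
begin

text \<open>
  Write \<open>W\<close> for the Hessian at the current point and \<open>\<xi>\<close> for the unbiased subgradient. Since \<open>W\<close> is
  symmetric and positive definite, \<open>\<langle>a, b\<rangle>\<^sub>W = a \<bullet> W b\<close> is an inner product, the control set is a ball
  for its norm, and the objective is \<open>\<langle>\<xi>, u\<rangle>\<^sub>W\<close>. The equality case of the Cauchy--Schwarz inequality
  then forces a maximizer to be \<open>c \<xi>\<close> with \<open>c = sqrt (\<Delta> / \<langle>\<xi>, \<xi>\<rangle>\<^sub>W) > 0\<close>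
  (\<open>quadratic_form_maximizer_direction\<close>). As \<open>\<xi>\<close> is a positive multiple of \<open>q \<circ> \<lambda>\<close> and \<open>\<lambda>\<close> is a
  negative multiple of the gradient, the step \<open>h u\<close> is a negative multiple of \<open>q \<circ> \<partial>E\<close>.

  Symmetry of \<open>W\<close> is essential, and it is not part of positive definiteness as defined here. It is
  Schwarz's theorem (\<open>derivative_of_gradient_symmetric\<close>), proved below for a function that has a
  gradient everywhere, the gradient being differentiable at the point: the second difference of \<open>f\<close> along \<open>s a\<close> and
  \<open>s b\<close> is symmetric in \<open>a\<close> and \<open>b\<close>, and divided by \<open>s\<^sup>2\<close> it tends to \<open>D(\<partial>f) b \<bullet> a\<close> as \<open>s\<close>
  tends to 0 from above.
\<close>

text \<open>
  The mean value theorem in the direction \<open>a\<close> turns the second difference into a difference of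
  gradients at two points near \<open>x\<close>, both controlled by the derivative \<open>A\<close> of the gradient at \<open>x\<close>.
\<close>
lemma second_difference_approx:
  fixes f :: "'a::real_inner \<Rightarrow> real"
  assumes grad: "\<And>y. GDERIV f y :> g y"
    and A: "(g has_derivative A) (at x)"
    and "e > 0"
  shows "\<exists>d>0. \<forall>s. 0 < s \<longrightarrow> s < d \<longrightarrow>
    \<bar>f (x + s *\<^sub>R a + s *\<^sub>R b) - f (x + s *\<^sub>R a) - f (x + s *\<^sub>R b) + f x - s\<^sup>2 * (A b \<bullet> a)\<bar> \<le> e * s\<^sup>2"
proof -
  \<comment> \<open>\<open>e'\<close> is chosen so that \<open>2 * e' * C\<^sup>2 \<le> e\<close>; the \<open>+ 1\<close> only guards against \<open>C = 0\<close>, here and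
    in the bound \<open>d' / (C + 1)\<close> on \<open>s\<close>.\<close>
  define C where "C = norm a + norm b"
  define R where "R h = g (x + h) - g x - A h" for h
  define e' where "e' = e / (2 * C\<^sup>2 + 1)"
  have C: "C \<ge> 0" "norm a \<le> C" by (simp_all add: C_def)
  have pos: "2 * C\<^sup>2 + 1 > 0" using zero_le_power2[of C] by linarith
  have e': "e' > 0" using \<open>e > 0\<close> pos by (simp add: e'_def)
  interpret A: bounded_linear A using A by (rule has_derivative_bounded_linear)
  obtain d' where d': "d' > 0"
    and d'R: "\<And>y. norm (y - x) < d' \<Longrightarrow> norm (g y - g x - A (y - x)) \<le> e' * norm (y - x)"
    using A e' unfolding has_derivative_at_alt by blast
  have R: "norm (R h) \<le> e' * norm h" if "norm h < d'" for h
    using d'R[of "x + h"] that by (simp add: R_def)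
  have "\<bar>f (x + s *\<^sub>R a + s *\<^sub>R b) - f (x + s *\<^sub>R a) - f (x + s *\<^sub>R b) + f x - s\<^sup>2 * (A b \<bullet> a)\<bar> \<le> e * s\<^sup>2"
    if s: "0 < s" "s < d' / (C + 1)" for s
  proof -
    \<comment> \<open>\<open>p s - p 0\<close> is the second difference.\<close>
    define p where "p r = f (x + r *\<^sub>R a + s *\<^sub>R b) - f (x + r *\<^sub>R a)" for r
    have line: "((\<lambda>r. f (y + r *\<^sub>R a)) has_real_derivative (g (y + r *\<^sub>R a) \<bullet> a)) (at r)" for y r
    proof -
      have "(f has_derivative (\<lambda>h. h \<bullet> g (y + r *\<^sub>R a))) (at (y + r *\<^sub>R a))"
        using grad unfolding gderiv_def .
      then have "((\<lambda>r. f (y + r *\<^sub>R a)) has_derivative (\<lambda>t. (t *\<^sub>R a) \<bullet> g (y + r *\<^sub>R a))) (at r)"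
        by (rule has_derivative_compose[rotated]) (auto intro!: derivative_eq_intros)
      then show ?thesis
        unfolding has_field_derivative_def
        by (rule has_derivative_eq_rhs) (simp add: fun_eq_iff inner_commute)
    qed
    have dp: "(p has_real_derivative ((g (x + r *\<^sub>R a + s *\<^sub>R b) - g (x + r *\<^sub>R a)) \<bullet> a)) (at r)" for r
      using DERIV_diff[OF line[of "x + s *\<^sub>R b" r] line[of x r]]
      unfolding p_def by (simp add: inner_diff_left add_ac)
    obtain z where z: "0 < z" "z < s"
      and "p s - p 0 = (s - 0) * ((g (x + z *\<^sub>R a + s *\<^sub>R b) - g (x + z *\<^sub>R a)) \<bullet> a)"
      using MVT2[OF s(1) dp] by auto
    then have pz: "p s - p 0 = s * ((g (x + z *\<^sub>R a + s *\<^sub>R b) - g (x + z *\<^sub>R a)) \<bullet> a)" by simp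
    have bound: "s * C < d'"
    proof -
      have "s * (C + 1) < d'" using s C by (simp add: pos_less_divide_eq)
      then show ?thesis using s by (simp add: distrib_left)
    qed
    have n1: "norm (z *\<^sub>R a) \<le> s * C"
      using z C by (auto intro!: mult_mono)
    have "norm (z *\<^sub>R a + s *\<^sub>R b) \<le> norm (z *\<^sub>R a) + norm (s *\<^sub>R b)"
      by (rule norm_triangle_ineq)
    also have "\<dots> \<le> s * norm a + s * norm b"
      using z s by (auto intro!: add_mono mult_right_mono)
    finally have n2: "norm (z *\<^sub>R a + s *\<^sub>R b) \<le> s * C" by (simp add: C_def distrib_left)
    have R1: "norm (R h) \<le> e' * (s * C)" if "norm h \<le> s * C" for h
      using R[of h] that bound e' by (smt (verit) mult_left_mono)
    have split: "g (x + z *\<^sub>R a + s *\<^sub>R b) - g (x + z *\<^sub>R a)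
        = s *\<^sub>R A b + (R (z *\<^sub>R a + s *\<^sub>R b) - R (z *\<^sub>R a))"
      by (simp add: R_def A.add A.scaleR add.assoc)
    have R2: "norm (R (z *\<^sub>R a + s *\<^sub>R b) - R (z *\<^sub>R a)) \<le> e' * (s * C) + e' * (s * C)"
      using norm_triangle_ineq4[of "R (z *\<^sub>R a + s *\<^sub>R b)" "R (z *\<^sub>R a)"] R1[OF n1] R1[OF n2]
      by linarith
    have "\<bar>(R (z *\<^sub>R a + s *\<^sub>R b) - R (z *\<^sub>R a)) \<bullet> a\<bar>
        \<le> norm (R (z *\<^sub>R a + s *\<^sub>R b) - R (z *\<^sub>R a)) * norm a"
      by (rule Cauchy_Schwarz_ineq2)
    also have "\<dots> \<le> (e' * (s * C) + e' * (s * C)) * C"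
      using C e' s by (intro mult_mono R2) auto
    also have "\<dots> = s * (e' * (2 * C\<^sup>2))" by (simp add: power2_eq_square)
    also have "\<dots> \<le> s * e"
      using s pos \<open>e > 0\<close> unfolding e'_def by (intro mult_left_mono) (auto simp: divide_simps)
    finally have rem: "\<bar>(R (z *\<^sub>R a + s *\<^sub>R b) - R (z *\<^sub>R a)) \<bullet> a\<bar> \<le> s * e" .
    have "f (x + s *\<^sub>R a + s *\<^sub>R b) - f (x + s *\<^sub>R a) - f (x + s *\<^sub>R b) + f x - s\<^sup>2 * (A b \<bullet> a)
        = s * ((R (z *\<^sub>R a + s *\<^sub>R b) - R (z *\<^sub>R a)) \<bullet> a)"
      using pz unfolding split by (simp add: p_def inner_add_left power2_eq_square distrib_left)
    then show ?thesis
      using mult_left_mono[OF rem, of s] s by (simp add: abs_mult power2_eq_square mult_ac)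
  qed
  then show ?thesis using d' C by (intro exI[of _ "d' / (C + 1)"]) auto
qed

lemma derivative_of_gradient_symmetric:
  fixes f :: "'a::real_inner \<Rightarrow> real"
  assumes grad: "\<And>y. GDERIV f y :> g y" and A: "(g has_derivative A) (at x)"
  shows "A a \<bullet> b = A b \<bullet> a"
proof -
  have "\<bar>A b \<bullet> a - A a \<bullet> b\<bar> \<le> e" if "e > 0" for e
  proof -
    define D where "D s = f (x + s *\<^sub>R a + s *\<^sub>R b) - f (x + s *\<^sub>R a) - f (x + s *\<^sub>R b) + f x" for s
    have e: "e / 2 > 0" using that by simp
    obtain d1 where d1: "d1 > 0"
      "\<And>s. 0 < s \<Longrightarrow> s < d1 \<Longrightarrow> \<bar>D s - s\<^sup>2 * (A b \<bullet> a)\<bar> \<le> e / 2 * s\<^sup>2"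
      using second_difference_approx[OF grad A e, of a b] unfolding D_def by blast
    have swap: "D s = f (x + s *\<^sub>R b + s *\<^sub>R a) - f (x + s *\<^sub>R b) - f (x + s *\<^sub>R a) + f x" for s
      by (simp add: D_def add_ac)
    obtain d2 where d2: "d2 > 0"
      "\<And>s. 0 < s \<Longrightarrow> s < d2 \<Longrightarrow> \<bar>D s - s\<^sup>2 * (A a \<bullet> b)\<bar> \<le> e / 2 * s\<^sup>2"
      using second_difference_approx[OF grad A e, of b a] unfolding swap by blast
    define s where "s = min d1 d2 / 2"
    have s: "0 < s" "s < d1" "s < d2" using d1(1) d2(1) by (auto simp: s_def)
    have "\<bar>s\<^sup>2 * (A b \<bullet> a) - s\<^sup>2 * (A a \<bullet> b)\<bar> \<le> e / 2 * s\<^sup>2 + e / 2 * s\<^sup>2"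
      using d1(2)[OF s(1,2)] d2(2)[OF s(1,3)] by linarith
    also have "\<dots> = s\<^sup>2 * e" by simp
    finally have "\<bar>s\<^sup>2 * (A b \<bullet> a) - s\<^sup>2 * (A a \<bullet> b)\<bar> \<le> s\<^sup>2 * e" .
    then have "s\<^sup>2 * \<bar>A b \<bullet> a - A a \<bullet> b\<bar> \<le> s\<^sup>2 * e"
      by (simp add: abs_mult flip: right_diff_distrib)
    then show ?thesis using s by simp
  qed
  then have "\<bar>A b \<bullet> a - A a \<bullet> b\<bar> \<le> 0" by (rule field_le_epsilon) simp
  then show ?thesis by simp
qed

text \<open>
  Differentiability makes the definite description behind \<open>gradient\<close> denote the Riesz
  representative of the Frechet derivative.
\<close>
lemma GDERIV_gradient:
  fixes f :: "'a::euclidean_space \<Rightarrow> real"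
  assumes "f differentiable at x"
  shows "GDERIV f x :> gradient f x"
  unfolding gradient_def
proof (rule theI')
  obtain f' where f': "(f has_derivative f') (at x)"
    using assms unfolding differentiable_def by blast
  then have "linear f'" by (rule has_derivative_linear)
  then have "f' = (\<lambda>h. h \<bullet> adjoint f' 1)"
    using adjoint_works[of f' _ 1] by (simp add: fun_eq_iff)
  then have ex: "GDERIV f x :> adjoint f' 1"
    using f' unfolding gderiv_def by simp
  show "\<exists>!D. GDERIV f x :> D"
  proof (intro ex1I[where a = "adjoint f' 1"] ex)
    fix D assume "GDERIV f x :> D"
    then have "(\<lambda>h. h \<bullet> D) = (\<lambda>h. h \<bullet> adjoint f' 1)"
      using ex has_derivative_unique unfolding gderiv_def by blast
    then show "D = adjoint f' 1" by (metis vector_eq_ldot)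
  qed
qed

lemma hessian_symmetric:
  fixes E :: "real^'n \<Rightarrow> real"
  assumes "twice_continuously_differentiable E"
  shows "a \<bullet> (hessian E x *v b) = b \<bullet> (hessian E x *v a)"
proof -
  have "(gradient E has_derivative (\<lambda>h. hessian E x *v h)) (at x)"
    using assms jacobian_works unfolding twice_continuously_differentiable_def hessian_def by blast
  moreover have "GDERIV E y :> gradient E y" for y
    using assms GDERIV_gradient unfolding twice_continuously_differentiable_def by blast
  ultimately show ?thesis
    using derivative_of_gradient_symmetric[of E "gradient E"] by (metis inner_commute)
qed

text \<open>Equality case of Cauchy--Schwarz for the inner product defined by \<open>W\<close>.\<close>
lemma quadratic_form_maximizer_direction:
  fixes W :: "real^'n^'n"
  assumes sym: "\<And>a b. a \<bullet> (W *v b) = b \<bullet> (W *v a)"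
    and pd: "positive_definite W"
    and "D > 0" and "xi \<noteq> 0"
    and feas: "u \<bullet> (W *v u) \<le> D"
    and max: "\<And>v. v \<bullet> (W *v v) \<le> D \<Longrightarrow> xi \<bullet> (W *v v) \<le> xi \<bullet> (W *v u)"
  shows "\<exists>c>0. u = c *\<^sub>R xi"
proof -
  define P where "P = xi \<bullet> (W *v xi)"
  \<comment> \<open>\<open>c\<close> scales \<open>\<xi>\<close> to the boundary of the ellipsoid; optimality of \<open>u\<close> against this competitor
    makes the squared \<open>W\<close>-norm of \<open>u - c \<xi>\<close> nonpositive.\<close>
  define c where "c = sqrt (D / P)"
  have P: "P > 0" using pd \<open>xi \<noteq> 0\<close> unfolding positive_definite_def P_def by blast
  then have c: "c > 0" and cP: "c\<^sup>2 * P = D" using \<open>D > 0\<close> by (simp_all add: c_def)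
  have "(c *\<^sub>R xi) \<bullet> (W *v (c *\<^sub>R xi)) = D"
    using cP by (simp add: matrix_vector_mult_scaleR P_def power2_eq_square mult.assoc)
  from max[OF eq_refl[OF this]] have "c * P \<le> xi \<bullet> (W *v u)"
    by (simp add: matrix_vector_mult_scaleR P_def)
  then have "c * (c * P) \<le> c * (xi \<bullet> (W *v u))"
    using c by (intro mult_left_mono) auto
  then have ge: "D \<le> c * (xi \<bullet> (W *v u))"
    using cP by (simp add: power2_eq_square mult.assoc)
  have "(u - c *\<^sub>R xi) \<bullet> (W *v (u - c *\<^sub>R xi)) = u \<bullet> (W *v u) - 2 * (c * (xi \<bullet> (W *v u))) + c\<^sup>2 * P"
    using sym[of u xi]
    by (simp add: matrix_vector_mult_scaleR matrix_vector_mult_diff_distrib inner_diff_left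
        inner_diff_right P_def power2_eq_square algebra_simps)
  also have "\<dots> \<le> 0" using feas ge cP by linarith
  finally have "u - c *\<^sub>R xi = 0"
    using pd unfolding positive_definite_def by (meson not_less)
  then show ?thesis using c by auto
qed

lemma qvec_times_nonzero:
  fixes l :: "real^'n"
  assumes "l \<noteq> 0"
  shows "qvec l * l \<noteq> 0"
proof
  assume eq: "qvec l * l = 0"
  have "(MAX j. (l $ j)\<^sup>2) \<in> range (\<lambda>j. (l $ j)\<^sup>2)" by (rule Max_in) auto
  then obtain i where i: "(MAX j. (l $ j)\<^sup>2) = (l $ i)\<^sup>2" by blast
  have "(qvec l * l) $ i = l $ i" by (simp add: qvec_def i)
  with eq have "(MAX j. (l $ j)\<^sup>2) = 0" using i by simp
  moreover have "(l $ j)\<^sup>2 \<le> (MAX j. (l $ j)\<^sup>2)" for j by (rule Max_ge) auto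
  ultimately have "l $ j = 0" for j by simp
  then show False using assms by (simp add: vec_eq_iff)
qed

theorem proposition2:
  fixes E :: "real^'n \<Rightarrow> real" and \<Delta> :: "real^'n \<Rightarrow> real"
    and \<nu>\<^sub>0 :: real and h :: "nat \<Rightarrow> real"
    and x u lam xi :: "nat \<Rightarrow> real^'n"
  assumes "strictly_convex_on UNIV E"
    and "twice_continuously_differentiable E"
    and "\<And>y. positive_definite (hessian E y)"
    and "\<And>y. \<Delta> y > 0"
    and "\<nu>\<^sub>0 > 0"
    and "\<And>k. h k > 0"
    and "\<And>k. x (Suc k) = x k + h k *\<^sub>R u k"
    and "\<And>k. lam k = - (\<nu>\<^sub>0 *\<^sub>R gradient E (x k))"
    and "\<And>k. gradient E (x k) \<noteq> 0 \<Longrightarrow> is_unbiased_subgradient (lam k) (xi k)"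
    and "\<And>k. gradient E (x k) \<noteq> 0 \<Longrightarrow> solves_max_principle E \<Delta> (x k) (xi k) (u k)"
  shows "\<forall>k. gradient E (x k) \<noteq> 0 \<longrightarrow>
    (\<exists>\<alpha>>0. x (Suc k) = x k - \<alpha> *\<^sub>R (qvec (lam k) * gradient E (x k)))"
proof (intro allI impI)
  fix k assume nz: "gradient E (x k) \<noteq> 0"
  let ?g = "gradient E (x k)"
  let ?W = "hessian E (x k)"
  have lam: "lam k = - (\<nu>\<^sub>0 *\<^sub>R ?g)" by (rule assms(8))
  have "lam k \<noteq> 0" using lam nz \<open>\<nu>\<^sub>0 > 0\<close> by simp
  obtain \<gamma> where \<gamma>: "\<gamma> > 0" and xi: "xi k = \<gamma> *\<^sub>R (qvec (lam k) * lam k)"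
    using assms(9)[OF nz] unfolding is_unbiased_subgradient_def by blast
  have "xi k \<noteq> 0" using qvec_times_nonzero[OF \<open>lam k \<noteq> 0\<close>] \<gamma> xi by simp
  have feas: "u k \<bullet> (?W *v u k) \<le> \<Delta> (x k)"
    and max: "\<And>v. v \<bullet> (?W *v v) \<le> \<Delta> (x k) \<Longrightarrow> xi k \<bullet> (?W *v v) \<le> xi k \<bullet> (?W *v u k)"
    using assms(10)[OF nz]
    unfolding solves_max_principle_def is_arg_max_def control_set_def by (auto simp: not_less)
  obtain c where c: "c > 0" "u k = c *\<^sub>R xi k"
    using quadratic_form_maximizer_direction[OF hessian_symmetric[OF assms(2)] assms(3,4) \<open>xi k \<noteq> 0\<close> feas max]
    by blast
  let ?\<alpha> = "h k * c * \<gamma> * \<nu>\<^sub>0"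
  have "qvec (lam k) * lam k = - (\<nu>\<^sub>0 *\<^sub>R (qvec (lam k) * ?g))"
    by (subst (2) lam) (simp add: vec_eq_iff)
  then have "x (Suc k) = x k - ?\<alpha> *\<^sub>R (qvec (lam k) * ?g)"
    using assms(7)[of k] c(2) xi by simp
  moreover have "?\<alpha> > 0" using assms(6)[of k] c(1) \<gamma> \<open>\<nu>\<^sub>0 > 0\<close> by simp
  ultimately show "\<exists>\<alpha>>0. x (Suc k) = x k - \<alpha> *\<^sub>R (qvec (lam k) * ?g)" by blast
qed

end
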